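(* Let $K$ be a field of characteristic zero (e.g. $K=\mathbb Q$), and let $a(t)=a_0+a_1t+a_2t^2+\cdots$ and $b(t)=b_0+b_1t+b_2t^2+\cdots$ be formal power series over $K$ with $a_0\ne0$, $b_0=0$, $b_1\neq0$. Define the Sheffer sequence $\{f_q(n)\}_{q\ge0}$ by the generating function $$\sum_{q\ge0}\frac{f_q(n)}{q!}t^q=a(t)e^{n\,b(t)}.$$ Then $f_q(n)/b_1^q$ is a two-level polynomial of degree function $q$ and infinite depth.
   Context: $\mathbb N=\{0,1,2,\dots\}$. A numerical polynomial is $g\in\mathbb Q[x]$ with $g(q)\in\mathbb Z$ for all $q\in\mathbb Z$. Two-level polynomial (over $K$): let $g$ be an eventually nonnegative numerical polynomial, $S=\{q\in\mathbb N: g(q)\ge0\}$, $e:S\to\mathbb N\cup\{-1,\infty\}$. A two-level polynomial of degree function $g$ and depth function $e$ is a sequence of polynomials $\{f_q\}_{q\in S}$ in $K[n]$, $f_q(n)$ of degree $g(q)$, such that, writing $f_q(n)=\sum_{r\ge0}c_r(q)n^{g(q)-r}$ with $c_r(q)=0$ for $r>g(q)$, there exist polynomials $\{\phi_r\}_{r\ge0}$ in $K[q]$ with $c_r(q)=\phi_r(q)$ for every $q\in S$ and every $r\le e(q)$. Infinite depth means $e(q)=\infty$ for all $q\in S$, i.e. the equality holds for all $r\ge 0$ (including $r>g(q)$, where $\phi_r(q)=0$). *)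

theory Defs
  imports
    "HOL-Computational_Algebra.Polynomial"
    "HOL-Computational_Algebra.Formal_Power_Series"
    "HOL-Library.Extended_Real"
    "HOL-Library.FuncSet"
begin

definition numerical_poly :: "rat poly \<Rightarrow> bool" where
  "numerical_poly g \<longleftrightarrow> (\<forall>q::int. poly g (of_int q) \<in> \<int>)"

definition eventually_nonneg :: "rat poly \<Rightarrow> bool" where
  "eventually_nonneg g \<longleftrightarrow> (\<forall>\<^sub>F q in sequentially. poly g (of_nat q) \<ge> 0)"

definition nonneg_args :: "rat poly \<Rightarrow> nat set" where
  "nonneg_args g = {q. poly g (of_nat q) \<ge> 0}"

(* The coefficient c_r in p(n) = sum over r of c_r n^(d - r), where d >= degree p,
   with c_r = 0 for r > d (on nat, d - r would otherwise truncate to 0). *)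
definition coeff_from_top :: "nat \<Rightarrow> 'a::zero poly \<Rightarrow> nat \<Rightarrow> 'a" where
  "coeff_from_top d p r = (if r \<le> d then coeff p (d - r) else 0)"

(* The sequence f and the depth function e matter only on nonneg_args g. Depths live in
   ereal so that the values -1 and \<infinity> are available with the usual order.
   The zero polynomial has no degree, hence the explicit f q \<noteq> 0
   (the library sets degree 0 = 0). *)
definition two_level_polynomial ::
    "rat poly \<Rightarrow> (nat \<Rightarrow> ereal) \<Rightarrow> (nat \<Rightarrow> 'a::field_char_0 poly) \<Rightarrow> bool" where
  "two_level_polynomial g e f \<longleftrightarrow>
     numerical_poly g \<and> eventually_nonneg g \<and>
     e \<in> nonneg_args g \<rightarrow> range (\<lambda>m::nat. ereal (real m)) \<union> {-1, \<infinity>} \<and>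
     (\<forall>q\<in>nonneg_args g. f q \<noteq> 0 \<and> of_nat (degree (f q)) = poly g (of_nat q)) \<and>
     (\<exists>\<phi> :: nat \<Rightarrow> 'a poly. \<forall>q\<in>nonneg_args g. \<forall>r::nat. ereal (real r) \<le> e q \<longrightarrow>
        coeff_from_top (nat \<lfloor>poly g (of_nat q)\<rfloor>) (f q) r = poly (\<phi> r) (of_nat q))"

definition two_level_infinite_depth ::
    "rat poly \<Rightarrow> (nat \<Rightarrow> 'a::field_char_0 poly) \<Rightarrow> bool" where
  "two_level_infinite_depth g f \<longleftrightarrow> two_level_polynomial g (\<lambda>q. \<infinity>) f"

text \<open>The generating function is an element of \<open>K[n][[t]]\<close>, that is, of type
  \<open>'a poly fps\<close>: the inner variable is \<open>n\<close>, the outer one is \<open>t\<close>.\<close>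

definition lift_fps :: "'a::zero fps \<Rightarrow> 'a poly fps" where
  "lift_fps a = Abs_fps (\<lambda>k. [:fps_nth a k:])"

(* fps_exp 1 lifted to K[n][[t]]; fps_exp itself needs a coefficient field. The composition
   is the usual exponential of u only if u has constant term 0. *)
definition exp_fps :: "'a::field_char_0 poly fps \<Rightarrow> 'a poly fps" where
  "exp_fps u = fps_compose (lift_fps (fps_exp 1)) u"

definition sheffer_sequence :: "'a::field_char_0 fps \<Rightarrow> 'a fps \<Rightarrow> (nat \<Rightarrow> 'a poly) \<Rightarrow> bool" where
  "sheffer_sequence a b f \<longleftrightarrow>
     Abs_fps (\<lambda>q. smult (1 / fact q) (f q)) =
       lift_fps a * exp_fps (fps_const [:0, 1:] * lift_fps b)"

end

theory Submission
  imports Defs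
begin

text \<open>
  Expanding the exponential shows that the coefficient of \<open>n\<^sup>k\<close> in \<open>f\<^sub>q\<close> is \<open>q!/k!\<close> times the
  coefficient of \<open>t\<^sup>q\<close> in \<open>a b\<^sup>k\<close> (lemma \<open>coeff_sheffer\<close>). Since \<open>b\<close> has order exactly one, it
  can be written as \<open>b\<^sub>1 t (1 + d)\<close> with \<open>d\<close> of positive order. Hence the coefficient of \<open>n\<^sup>k\<close>
  in \<open>f\<^sub>q\<close> vanishes for \<open>k > q\<close>, and for \<open>k = q - r\<close> it is
  \[ r!\,{q \choose r}\, b_1^{q-r}\, [t^r]\, a (1+d)^{q-r} . \]
  For \<open>r = 0\<close> this is \<open>a\<^sub>0 b\<^sub>1\<^sup>q\<close>, so the degree is \<open>q\<close>.

  It remains to see that, after division by \<open>b\<^sub>1\<^sup>q\<close>, the expression is polynomial in \<open>q\<close> for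
  fixed \<open>r\<close>. In the binomial expansion of \<open>(1+d)\<^sup>m\<close> the terms \<open>d\<^sup>j\<close> with \<open>j > r\<close> do not reach
  \<open>t\<^sup>r\<close>, so \<open>[t\<^sup>r] a (1+d)\<^sup>m\<close> is a linear combination of the polynomials \<open>m choose j\<close> with
  \<open>j \<le> r\<close>, and neither their number nor their coefficients depend on \<open>m\<close>
  (lemma \<open>fps_nth_mult_one_plus_power\<close>). Infinite depth comes for free: the factor \<open>q choose r\<close> makes the polynomial vanish at every natural number \<open>q < r\<close>, where
  there is no coefficient left.
\<close>

lemma lift_fps_nth [simp]: "fps_nth (lift_fps a) k = [:fps_nth a k:]"
  by (simp add: lift_fps_def)

lemma lift_fps_mult: "lift_fps (a * b :: 'a::comm_ring_1 fps) = lift_fps a * lift_fps b"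
  by (intro fps_ext poly_eqI)
    (auto simp: fps_mult_nth coeff_sum coeff_pCons split: nat.split intro!: sum.cong)

lemma lift_fps_one: "lift_fps (1 :: 'a::comm_ring_1 fps) = 1"
  by (intro fps_ext) (simp add: one_pCons)

lemma lift_fps_power: "lift_fps (a ^ k :: 'a::comm_ring_1 fps) = lift_fps a ^ k"
  by (induction k) (simp_all add: lift_fps_mult lift_fps_one)

lemma fps_nth_power_eq_0:
  fixes d :: "'a::comm_ring_1 fps"
  assumes "fps_nth d 0 = 0" and "q < k"
  shows "fps_nth (d ^ k) q = 0"
  using startsby_zero_power_prefix[OF assms(1)] assms(2) by blast

lemma fps_nth_mult_power_eq_0:
  fixes a d :: "'a::comm_ring_1 fps"
  assumes "fps_nth d 0 = 0" and "q < k"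
  shows "fps_nth (a * d ^ k) q = 0"
  using assms by (auto simp: fps_mult_nth fps_nth_power_eq_0 intro!: sum.neutral)

text \<open>In \<open>exp (n b(t))\<close> the variable \<open>n\<close> counts the factors of \<open>b\<close>, so extracting \<open>n\<^sup>k\<close> isolates the
  single summand \<open>b\<^sup>k / k!\<close> of the exponential series.\<close>

lemma coeff_exp_fps:
  fixes b :: "'a::field_char_0 fps"
  assumes "fps_nth b 0 = 0"
  shows "coeff (fps_nth (exp_fps (fps_const [:0, 1:] * lift_fps b)) q) k
           = fps_nth (b ^ k) q / fact k"
proof -
  have term_eq: "fps_nth ((fps_const [:0, 1:] * lift_fps b) ^ i) q = monom (fps_nth (b ^ i) q) i"
    for i
    by (simp add: power_mult_distrib fps_const_power monom_altdef mult.commute[of "_ ^ i"]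
        flip: lift_fps_power)
  have "coeff (fps_nth (exp_fps (fps_const [:0, 1:] * lift_fps b)) q) k
          = (\<Sum>i=0..q. if i = k then fps_nth (b ^ i) q / fact i else 0)"
    unfolding exp_fps_def fps_compose_nth coeff_sum term_eq
    by (intro sum.cong) auto
  also have "\<dots> = fps_nth (b ^ k) q / fact k"
    using fps_nth_power_eq_0[OF assms, of q k] by auto
  finally show ?thesis .
qed

lemma coeff_sheffer:
  fixes a b :: "'a::field_char_0 fps"
  assumes "fps_nth b 0 = 0" and "sheffer_sequence a b f"
  shows "coeff (f q) k = fact q / fact k * fps_nth (a * b ^ k) q"
proof -
  have "smult (1 / fact q) (f q)
          = fps_nth (lift_fps a * exp_fps (fps_const [:0, 1:] * lift_fps b)) q"
    using assms(2) unfolding sheffer_sequence_def by (metis fps_nth_Abs_fps)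
  hence "coeff (f q) k / fact q
          = coeff (fps_nth (lift_fps a * exp_fps (fps_const [:0, 1:] * lift_fps b)) q) k"
    by (metis coeff_smult mult.commute mult.right_neutral times_divide_eq_right)
  also have "\<dots> = fps_nth (a * b ^ k) q / fact k"
    by (simp add: fps_mult_nth coeff_sum coeff_exp_fps[OF assms(1)] sum_divide_distrib)
  finally show ?thesis
    by (simp add: field_simps)
qed

definition binom_poly :: "nat \<Rightarrow> 'a::field_char_0 poly" where
  "binom_poly j = smult (1 / fact j) (\<Prod>i<j. [:- of_nat i, 1:])"

lemma poly_binom_poly: "poly (binom_poly j) (of_nat m :: 'a::field_char_0) = of_nat (m choose j)"
  by (simp add: binom_poly_def poly_prod binomial_gbinomial gbinomial_prod_rev atLeast0LessThan)

text \<open>The binomial expansion of \<open>(1 + d)\<^sup>m\<close> may be cut off at \<open>r\<close> instead of at \<open>m\<close>: a summand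
  with \<open>j > m\<close> has binomial coefficient zero, and one with \<open>j > r\<close> has order larger than \<open>r\<close>. The
  new bound makes the right-hand side a fixed polynomial in \<open>m\<close>.\<close>

lemma fps_nth_mult_one_plus_power:
  fixes a d :: "'a::field_char_0 fps"
  assumes "fps_nth d 0 = 0"
  shows "fps_nth (a * (1 + d) ^ m) r = (\<Sum>j\<le>r. of_nat (m choose j) * fps_nth (a * d ^ j) r)"
proof -
  have "(1 + d) ^ m = (\<Sum>j\<le>m. of_nat (m choose j) * d ^ j)"
    using binomial_ring[of d 1 m] by (simp add: add.commute)
  hence "a * (1 + d) ^ m = (\<Sum>j\<le>m. fps_const (of_nat (m choose j)) * (a * d ^ j))"
    by (simp add: sum_distrib_left fps_of_nat mult_ac)
  hence "fps_nth (a * (1 + d) ^ m) r = (\<Sum>j\<le>m. of_nat (m choose j) * fps_nth (a * d ^ j) r)"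
    by (simp add: fps_sum_nth)
  also have "\<dots> = (\<Sum>j\<le>max m r. of_nat (m choose j) * fps_nth (a * d ^ j) r)"
    by (intro sum.mono_neutral_left) auto
  also have "\<dots> = (\<Sum>j\<le>r. of_nat (m choose j) * fps_nth (a * d ^ j) r)"
    using assms by (intro sum.mono_neutral_right) (auto simp: fps_nth_mult_power_eq_0)
  finally show ?thesis .
qed

lemma fps_order_one_factorization:
  fixes b :: "'a::field fps"
  assumes "fps_nth b 0 = 0" and "fps_nth b 1 \<noteq> 0"
  obtains d where "fps_nth d 0 = 0" and "b = fps_const (fps_nth b 1) * (fps_X * (1 + d))"
proof
  let ?d = "fps_const (1 / fps_nth b 1) * fps_shift 1 b - 1"
  show "fps_nth ?d 0 = 0"
    using assms(2) by simp
  show "b = fps_const (fps_nth b 1) * (fps_X * (1 + ?d))"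
    using assms by (intro fps_ext) auto
qed

theorem theorem51:
  fixes a b :: "'a::field_char_0 fps" and f :: "nat \<Rightarrow> 'a poly"
  assumes "fps_nth a 0 \<noteq> 0" and "fps_nth b 0 = 0" and "fps_nth b 1 \<noteq> 0"
    and "sheffer_sequence a b f"
  shows "two_level_infinite_depth [:0, 1:] (\<lambda>q. smult (1 / fps_nth b 1 ^ q) (f q))"
proof -
  define b1 where "b1 = fps_nth b 1"
  have b1: "b1 \<noteq> 0"
    using assms(3) by (simp add: b1_def)
  obtain d where d: "fps_nth d 0 = 0" and b_eq: "b = fps_const b1 * (fps_X * (1 + d))"
    using fps_order_one_factorization[OF assms(2,3)] unfolding b1_def by blast
  define g where "g q = smult (1 / b1 ^ q) (f q)" for q
  define P :: "nat \<Rightarrow> 'a poly" where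
    "P r = (\<Sum>j\<le>r. smult (fps_nth (a * d ^ j) r) (binom_poly j))" for r
  \<comment> \<open>The argument of \<open>P r\<close> is the exponent \<open>q - r\<close>, whence the shift.\<close>
  define \<phi> :: "nat \<Rightarrow> 'a poly" where
    "\<phi> r = smult (fact r / b1 ^ r) (binom_poly r * pcompose (P r) [:- of_nat r, 1:])" for r

  have P: "poly (P r) (of_nat m) = fps_nth (a * (1 + d) ^ m) r" for r m
    by (simp add: P_def poly_sum poly_binom_poly fps_nth_mult_one_plus_power[OF d] mult.commute)
  have \<phi>: "poly (\<phi> r) (of_nat q)
             = fact r * of_nat (q choose r) / b1 ^ r * poly (P r) (of_nat q - of_nat r)" for r q
    by (simp add: \<phi>_def poly_pcompose poly_binom_poly algebra_simps)

  have coeff_low: "coeff (g (m + r)) m = poly (\<phi> r) (of_nat (m + r))" for m r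
  proof -
    have "a * b ^ m = fps_const (b1 ^ m) * (fps_X ^ m * (a * (1 + d) ^ m))"
      by (subst b_eq) (simp add: power_mult_distrib fps_const_power mult_ac)
    hence "fps_nth (a * b ^ m) (m + r) = b1 ^ m * fps_nth (a * (1 + d) ^ m) r"
      by (simp only: fps_mult_left_const_nth fps_X_power_mult_nth) simp
    hence "coeff (g (m + r)) m
             = fact (m + r) / fact m / b1 ^ r * fps_nth (a * (1 + d) ^ m) r"
      using b1 by (simp add: g_def coeff_sheffer[OF assms(2,4)] power_add)
    moreover have "(fact (m + r) :: 'a) / fact m = fact r * of_nat ((m + r) choose r)"
      by (simp add: binomial_fact)
    ultimately show ?thesis
      using P[of r m] \<phi>[of r "m + r"] by simp
  qed
  have coeff_high: "coeff (g q) k = 0" if "q < k" for q k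
    using fps_nth_mult_power_eq_0[OF assms(2) that]
    by (simp add: g_def coeff_sheffer[OF assms(2,4)])
  have lead: "coeff (g q) q \<noteq> 0" for q
    using coeff_low[of q 0] P[of 0 q] \<phi>[of 0 q] assms(1) d
    by (simp add: fps_mult_nth_0 fps_nth_power_0)
  have degree: "degree (g q) = q" for q
    using lead[of q] coeff_high by (meson degree_le le_antisym le_degree)
  have expansion: "coeff_from_top q (g q) r = poly (\<phi> r) (of_nat q)" for q r
  proof (cases "r \<le> q")
    case True
    thus ?thesis
      using coeff_low[of "q - r" r] by (simp add: coeff_from_top_def)
  next
    case False
    thus ?thesis
      by (simp add: coeff_from_top_def \<phi>)
  qed

  have "two_level_infinite_depth [:0, 1:] g"
    unfolding two_level_infinite_depth_def two_level_polynomial_def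
  proof (intro conjI exI[of _ \<phi>] ballI allI impI)
    show "numerical_poly [:0, 1:]"
      by (simp add: numerical_poly_def)
    show "eventually_nonneg [:0, 1:]"
      by (simp add: eventually_nonneg_def)
    show "g q \<noteq> 0" for q
      using lead[of q] by auto
  qed (auto simp: degree expansion)
  thus ?thesis
    unfolding g_def b1_def .
qed

end
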